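(* Let $\mathbb Z[\varepsilon]=\mathbb Z[T]/(T^2)$ be the ring of dual integers. (1) The category $\operatorname{G-proj}\mathbb Z[\varepsilon]$ of Gorenstein-projective $\mathbb Z[\varepsilon]$-modules is exactly the category $\operatorname{sub}(\mathbb Z[\varepsilon])$ of torsionless $\mathbb Z[\varepsilon]$-modules. (2) Every Gorenstein-projective $\mathbb Z[\varepsilon]$-module is strongly Gorenstein-projective.
   Context: All modules are finitely generated right modules. $\operatorname{sub}(\mathbb Z[\varepsilon])$ is the full subcategory of $\operatorname{mod}\mathbb Z[\varepsilon]$ of torsionless modules, i.e. modules (isomorphic to) submodules of $\mathbb Z[\varepsilon]^n$ for some $n$. A $\Lambda$-module $M$ is Gorenstein-projective if there is a doubly infinite exact sequence $P^\bullet:\cdots\to P^{-1}\to P^0\xrightarrow{d^0}P^1\to P^2\to\cdots$ of finitely generated projective $\Lambda$-modules such that the dual sequence $\operatorname{Hom}_\Lambda(P^\bullet,\Lambda)$ is exact and $M\cong\operatorname{Ker}d^0$. It is strongly Gorenstein-projective if all the modules $P^i$ and all the maps $d^i$ in such a sequence can be chosen to be equal. $\operatorname{G-proj}\Lambda$ is the full subcategory of $\operatorname{mod}\Lambda$ of Gorenstein-projective modules. *)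

theory Defs
  imports HOL.Hull "HOL-Algebra.IntRing" "HOL-Algebra.UnivPoly"
begin

text \<open>
  All rings below are commutative, so right modules are modules in the sense of the locale
  \<^locale>\<open>module\<close>. The fields \<open>mult\<close> and \<open>one\<close> that a module record inherits from
  the ring record carry no information.
\<close>

subsection \<open>The ring of dual integers\<close>

definition dual_integers :: "(nat \<Rightarrow> int) set ring"
  where "dual_integers =
    UP \<Z> Quot (Idl\<^bsub>UP \<Z>\<^esub> {monom (UP \<Z>) 1 1 [^]\<^bsub>UP \<Z>\<^esub> (2::nat)})"

lemma cring_dual_integers: "cring dual_integers"
proof -
  interpret UP_cring \<Z> "UP \<Z>"
    by (simp add: UP_cring.intro int_is_cring)
  have "monom (UP \<Z>) 1 1 [^]\<^bsub>UP \<Z>\<^esub> (2::nat) \<in> carrier (UP \<Z>)"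
    by (intro P.nat_pow_closed monom_closed) simp
  then have "ideal (Idl\<^bsub>UP \<Z>\<^esub> {monom (UP \<Z>) 1 1 [^]\<^bsub>UP \<Z>\<^esub> (2::nat)}) (UP \<Z>)"
    by (intro P.genideal_ideal) simp
  then show ?thesis
    unfolding dual_integers_def
    by (rule ideal.quotient_is_cring) (rule P.is_cring)
qed


subsection \<open>Finitely generated modules\<close>

definition fg_modules :: "('r, 'x) ring_scheme \<Rightarrow> ('r, 'm) module set"
  where "fg_modules R = {M. module R M \<and>
    (\<exists>S. finite S \<and> S \<subseteq> carrier M \<and> (\<lambda>N. submodule N R M) hull S = carrier M)}"

definition module_hom ::
    "('r, 'x) ring_scheme \<Rightarrow> ('r, 'm, 'y) module_scheme \<Rightarrow> ('r, 'n, 'z) module_scheme \<Rightarrow> ('m \<Rightarrow> 'n) set"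
  where "module_hom R M N = {f \<in> carrier M \<rightarrow> carrier N.
    (\<forall>x\<in>carrier M. \<forall>y\<in>carrier M. f (x \<oplus>\<^bsub>M\<^esub> y) = f x \<oplus>\<^bsub>N\<^esub> f y) \<and>
    (\<forall>a\<in>carrier R. \<forall>x\<in>carrier M. f (a \<odot>\<^bsub>M\<^esub> x) = a \<odot>\<^bsub>N\<^esub> f x)}"

definition module_iso ::
    "('r, 'x) ring_scheme \<Rightarrow> ('r, 'm, 'y) module_scheme \<Rightarrow> ('r, 'n, 'z) module_scheme \<Rightarrow> bool"
  where "module_iso R M N \<longleftrightarrow> (\<exists>f\<in>module_hom R M N. bij_betw f (carrier M) (carrier N))"

definition module_ker ::
    "('r, 'm) module \<Rightarrow> ('r, 'n) module \<Rightarrow> ('m \<Rightarrow> 'n) \<Rightarrow> ('r, 'm) module"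
  where "module_ker M N f = M\<lparr>carrier := {x \<in> carrier M. f x = \<zero>\<^bsub>N\<^esub>}\<rparr>"

definition exact_at ::
    "('r, 'l) module \<Rightarrow> ('l \<Rightarrow> 'm) \<Rightarrow> ('r, 'm) module \<Rightarrow> ('m \<Rightarrow> 'n) \<Rightarrow> ('r, 'n) module \<Rightarrow> bool"
  where "exact_at L f M g N \<longleftrightarrow> f ` carrier L = carrier (module_ker M N g)"

definition free_module :: "('r, 'x) ring_scheme \<Rightarrow> nat \<Rightarrow> ('r, nat \<Rightarrow> 'r) module"
  where "free_module R n = \<lparr>
    carrier = {..<n} \<rightarrow>\<^sub>E carrier R,
    mult = (\<lambda>f g. undefined),
    one = undefined,
    zero = (\<lambda>i\<in>{..<n}. \<zero>\<^bsub>R\<^esub>),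
    add = (\<lambda>f g. \<lambda>i\<in>{..<n}. f i \<oplus>\<^bsub>R\<^esub> g i),
    smult = (\<lambda>a f. \<lambda>i\<in>{..<n}. a \<otimes>\<^bsub>R\<^esub> f i)\<rparr>"

text \<open>
  The module \<open>Hom(M, R)\<close>. Homomorphisms are taken to be extensional, so that two of them are
  equal as soon as they agree on the carrier of \<open>M\<close>.
\<close>

definition dual_module :: "('r, 'x) ring_scheme \<Rightarrow> ('r, 'm) module \<Rightarrow> ('r, 'm \<Rightarrow> 'r) module"
  where "dual_module R M = \<lparr>
    carrier = {\<phi> \<in> carrier M \<rightarrow>\<^sub>E carrier R.
      (\<forall>x\<in>carrier M. \<forall>y\<in>carrier M. \<phi> (x \<oplus>\<^bsub>M\<^esub> y) = \<phi> x \<oplus>\<^bsub>R\<^esub> \<phi> y) \<and>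
      (\<forall>a\<in>carrier R. \<forall>x\<in>carrier M. \<phi> (a \<odot>\<^bsub>M\<^esub> x) = a \<otimes>\<^bsub>R\<^esub> \<phi> x)},
    mult = (\<lambda>\<phi> \<psi>. undefined),
    one = undefined,
    zero = (\<lambda>x\<in>carrier M. \<zero>\<^bsub>R\<^esub>),
    add = (\<lambda>\<phi> \<psi>. \<lambda>x\<in>carrier M. \<phi> x \<oplus>\<^bsub>R\<^esub> \<psi> x),
    smult = (\<lambda>a \<phi>. \<lambda>x\<in>carrier M. a \<otimes>\<^bsub>R\<^esub> \<phi> x)\<rparr>"

lemma module_free_module:
  assumes "cring R"
  shows "module R (free_module R n)"
proof -
  interpret cring R by fact
  show ?thesis
  proof (intro moduleI abelian_groupI)
    fix x assume x: "x \<in> carrier (free_module R n)"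
    have "(\<lambda>i\<in>{..<n}. \<ominus>\<^bsub>R\<^esub> x i) \<in> carrier (free_module R n)"
      "(\<lambda>i\<in>{..<n}. \<ominus>\<^bsub>R\<^esub> x i) \<oplus>\<^bsub>free_module R n\<^esub> x = \<zero>\<^bsub>free_module R n\<^esub>"
      using x by (auto simp: free_module_def fun_eq_iff PiE_iff l_neg)
    then show "\<exists>y\<in>carrier (free_module R n). y \<oplus>\<^bsub>free_module R n\<^esub> x = \<zero>\<^bsub>free_module R n\<^esub>"
      by blast
  qed (use assms in \<open>auto simp: free_module_def fun_eq_iff PiE_iff extensional_def
      l_distr r_distr m_assoc a_ac\<close>)
qed

lemma module_dual_module:
  assumes "module R M"
  shows "module R (dual_module R M)"
proof -
  interpret module R M by fact
  show ?thesis
  proof (intro moduleI abelian_groupI)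
    fix \<phi> assume x: "\<phi> \<in> carrier (dual_module R M)"
    have "(\<lambda>x\<in>carrier M. \<ominus>\<^bsub>R\<^esub> \<phi> x) \<in> carrier (dual_module R M)"
      "(\<lambda>x\<in>carrier M. \<ominus>\<^bsub>R\<^esub> \<phi> x) \<oplus>\<^bsub>dual_module R M\<^esub> \<phi> = \<zero>\<^bsub>dual_module R M\<^esub>"
      using x by (auto simp: dual_module_def fun_eq_iff PiE_iff R.l_neg R.minus_add R.r_minus)
    then show "\<exists>y\<in>carrier (dual_module R M). y \<oplus>\<^bsub>dual_module R M\<^esub> \<phi> = \<zero>\<^bsub>dual_module R M\<^esub>"
      by blast
  qed (auto simp: dual_module_def fun_eq_iff PiE_iff extensional_def R.is_cring
      R.l_distr R.r_distr R.m_assoc R.m_lcomm R.a_ac)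
qed


subsection \<open>Torsionless modules\<close>

definition sub :: "('r, 'x) ring_scheme \<Rightarrow> ('r, 'm) module set"
  where "sub R = {M \<in> fg_modules R.
    \<exists>n N. submodule N R (free_module R n) \<and> module_iso R M ((free_module R n)\<lparr>carrier := N\<rparr>)}"


subsection \<open>Gorenstein-projective modules\<close>

text \<open>A finitely generated projective module is a direct summand, up to isomorphism, of some \<open>R\<^sup>n\<close>.\<close>

definition fg_projective :: "('r, 'x) ring_scheme \<Rightarrow> ('r, 'm) module \<Rightarrow> bool"
  where "fg_projective R P \<longleftrightarrow> module R P \<and>
    (\<exists>n A B. submodule A R (free_module R n) \<and> submodule B R (free_module R n) \<and>
      A \<inter> B = {\<zero>\<^bsub>free_module R n\<^esub>} \<and> A <+>\<^bsub>free_module R n\<^esub> B = carrier (free_module R n) \<and>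
      module_iso R P ((free_module R n)\<lparr>carrier := A\<rparr>))"

definition dual_map ::
    "('r, 'm) module \<Rightarrow> ('m \<Rightarrow> 'n) \<Rightarrow> ('n \<Rightarrow> 'r) \<Rightarrow> ('m \<Rightarrow> 'r)"
  where "dual_map M d = (\<lambda>\<phi>. compose (carrier M) \<phi> d)"

definition totally_acyclic ::
    "('r, 'x) ring_scheme \<Rightarrow> (int \<Rightarrow> ('r, 'p) module) \<Rightarrow> (int \<Rightarrow> 'p \<Rightarrow> 'p) \<Rightarrow> bool"
  where "totally_acyclic R P d \<longleftrightarrow> (\<forall>i.
    fg_projective R (P i) \<and>
    d i \<in> module_hom R (P i) (P (i + 1)) \<and>
    exact_at (P (i - 1)) (d (i - 1)) (P i) (d i) (P (i + 1)) \<and>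
    exact_at (dual_module R (P (i + 1))) (dual_map (P i) (d i))
      (dual_module R (P i)) (dual_map (P (i - 1)) (d (i - 1))) (dual_module R (P (i - 1))))"

text \<open>
  Every finitely generated projective module is isomorphic to a submodule of some \<open>R\<^sup>n\<close>, and the
  carrier of \<open>R\<^sup>n\<close> lives in the type \<^typ>\<open>nat \<Rightarrow> 'r\<close>. So it is no restriction to let the complexes
  below consist of modules with carrier in that type. The module \<open>M\<close> itself has its carrier in an
  arbitrary type.
\<close>

definition G_proj :: "('r, 'x) ring_scheme \<Rightarrow> ('r, 'm) module set"
  where "G_proj R = {M \<in> fg_modules R.
    \<exists>(P :: int \<Rightarrow> ('r, nat \<Rightarrow> 'r) module) d. totally_acyclic R P d \<and>
      module_iso R M (module_ker (P 0) (P 1) (d 0))}"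

definition strongly_G_proj :: "('r, 'x) ring_scheme \<Rightarrow> ('r, 'm) module set"
  where "strongly_G_proj R = {M \<in> fg_modules R.
    \<exists>(P :: ('r, nat \<Rightarrow> 'r) module) d. totally_acyclic R (\<lambda>i. P) (\<lambda>i. d) \<and>
      module_iso R M (module_ker P P d)}"

end

theory Submission
  imports Defs
begin

text \<open>
  A submodule \<open>N\<close> of \<open>\<Lambda>\<^sup>n\<close>, where \<open>\<Lambda> = \<int>[\<epsilon>]\<close>, is a subgroup of \<open>\<int>\<^sup>2\<^sup>n\<close>. It has a
  \<open>\<int>\<close>-basis that extends a basis of \<open>N \<inter> \<epsilon>\<Lambda>\<^sup>n\<close>. Multiplication by \<open>\<epsilon>\<close> has in this basis a
  matrix \<open>E\<close> that kills \<open>N \<inter> \<epsilon>\<Lambda>\<^sup>n\<close> and maps the other basis vectors into it. Let \<open>\<sigma>\<close>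
  be the diagonal matrix with entries \<open>1\<close> on the basis of \<open>N \<inter> \<epsilon>\<Lambda>\<^sup>n\<close> and \<open>-1\<close> on the other basis
  vectors. Then \<open>\<sigma>E = E = -E\<sigma>\<close>, hence \<open>d = \<epsilon>\<sigma> - E\<close> is an endomorphism of \<open>\<Lambda>\<^sup>r\<close> with
  \<open>d\<^sup>2 = 0\<close>, and the kernel of \<open>d\<close> is isomorphic to \<open>N\<close>.

  Over \<open>\<int>\<close> the complex with all differentials \<open>d\<close> has the contracting homotopy
  \<open>x + \<epsilon>y \<mapsto> \<sigma>y\<close>. This gives exactness, and also exactness of the dual complex, because
  \<open>Hom\<^sub>\<Lambda>(P, \<Lambda>)\<close> is naturally isomorphic to \<open>Hom\<^sub>\<int>(P, \<int>)\<close>.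
\<close>

subsection \<open>Coordinates on the dual integers\<close>

text \<open>A concrete model in which the pair (a, b) stands for a + b\<epsilon>. The isomorphism
  with it gives the elements of the quotient ring integer coordinates.\<close>

definition dual_pairs :: "(int \<times> int) ring"
  where "dual_pairs = \<lparr>
    carrier = UNIV,
    mult = (\<lambda>(a, b) (c, d). (a * c, a * d + b * c)),
    one = (1, 0),
    zero = (0, 0),
    add = (\<lambda>(a, b) (c, d). (a + c, b + d))\<rparr>"

lemma cring_dual_pairs: "cring dual_pairs"
proof (rule cringI)
  show "abelian_group dual_pairs"
  proof (rule abelian_groupI)
    fix x assume "x \<in> carrier dual_pairs"
    show "\<exists>y\<in>carrier dual_pairs. y \<oplus>\<^bsub>dual_pairs\<^esub> x = \<zero>\<^bsub>dual_pairs\<^esub>"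
      by (rule bexI[of _ "(- fst x, - snd x)"]) (auto simp: dual_pairs_def split: prod.splits)
  qed (auto simp: dual_pairs_def)
  show "Group.comm_monoid dual_pairs"
    by (rule comm_monoidI) (auto simp: dual_pairs_def algebra_simps)
qed (auto simp: dual_pairs_def algebra_simps)

context
begin

interpretation UP: UP_cring \<Z> "UP \<Z>"
  by (simp add: UP_cring.intro int_is_cring)

definition truncate :: "(nat \<Rightarrow> int) \<Rightarrow> int \<times> int"
  where "truncate p = (coeff (UP \<Z>) p 0, coeff (UP \<Z>) p 1)"

lemma ring_hom_truncate: "ring_hom_ring (UP \<Z>) dual_pairs truncate"
proof (rule ring_hom_ringI2)
  show "ring (UP \<Z>)" "ring dual_pairs"
    using UP.P.ring_axioms cring_dual_pairs cring.axioms(1) by auto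
  show "truncate \<in> ring_hom (UP \<Z>) dual_pairs"
  proof (rule ring_hom_memI)
    fix p q assume pq: "p \<in> carrier (UP \<Z>)" "q \<in> carrier (UP \<Z>)"
    have "coeff (UP \<Z>) (p \<otimes>\<^bsub>UP \<Z>\<^esub> q) n
        = (\<Sum>i\<le>n. coeff (UP \<Z>) p i * coeff (UP \<Z>) q (n - i))" for n
      using UP.coeff_mult[OF pq] by (simp add: int_finsum_eq)
    then show "truncate (p \<otimes>\<^bsub>UP \<Z>\<^esub> q) = truncate p \<otimes>\<^bsub>dual_pairs\<^esub> truncate q"
      by (simp add: truncate_def dual_pairs_def)
    show "truncate (p \<oplus>\<^bsub>UP \<Z>\<^esub> q) = truncate p \<oplus>\<^bsub>dual_pairs\<^esub> truncate q"
      using pq by (simp add: truncate_def dual_pairs_def)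
  qed (auto simp: truncate_def dual_pairs_def)
qed

lemma truncate_surj: "truncate ` carrier (UP \<Z>) = carrier dual_pairs"
proof -
  have "\<exists>p\<in>carrier (UP \<Z>). truncate p = (a, b)" for a b
    by (rule bexI[of _ "monom (UP \<Z>) a 0 \<oplus>\<^bsub>UP \<Z>\<^esub> monom (UP \<Z>) b 1"])
      (simp_all add: truncate_def)
  then show ?thesis
    by (auto simp: dual_pairs_def image_iff) metis
qed

text \<open>A polynomial with vanishing constant and linear coefficients is T^2 times its shift by
  two places. Conversely T^2 lies in the kernel, which is an ideal.\<close>

lemma kernel_truncate:
  "a_kernel (UP \<Z>) dual_pairs truncate
    = Idl\<^bsub>UP \<Z>\<^esub> {monom (UP \<Z>) 1 1 [^]\<^bsub>UP \<Z>\<^esub> (2::nat)}" (is "?K = Idl\<^bsub>_\<^esub> {?m}")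
proof -
  interpret h: ring_hom_ring "UP \<Z>" dual_pairs truncate
    by (rule ring_hom_truncate)
  have m: "?m = monom (UP \<Z>) 1 2"
    using UP.monom_pow[of 1 1 2] by simp
  have mc: "?m \<in> carrier (UP \<Z>)"
    unfolding m by simp
  have m_coeff: "coeff (UP \<Z>) ?m 0 = 0" "coeff (UP \<Z>) ?m (Suc 0) = 0"
    unfolding m by simp_all
  show ?thesis
  proof
    show "Idl\<^bsub>UP \<Z>\<^esub> {?m} \<subseteq> ?K"
    proof (rule UP.P.genideal_minimal[OF h.kernel_is_ideal])
      show "{?m} \<subseteq> ?K"
        using mc unfolding m a_kernel_def' by (simp add: truncate_def dual_pairs_def)
    qed
    show "?K \<subseteq> Idl\<^bsub>UP \<Z>\<^esub> {?m}"
    proof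
      fix p assume "p \<in> ?K"
      then have p: "p \<in> carrier (UP \<Z>)" "coeff (UP \<Z>) p 0 = 0" "coeff (UP \<Z>) p 1 = 0"
        by (auto simp: a_kernel_def' truncate_def dual_pairs_def)
      \<comment> \<open>The quotient of p by T^2, defined directly on coefficient functions.\<close>
      define q where "q = (\<lambda>n. p (n + 2))"
      have pup: "p \<in> up \<Z>"
        using p(1) by (simp add: UP_def)
      then obtain n where "bound 0 n p"
        by (auto simp: up_def)
      then have "bound 0 n q"
        by (auto simp: bound_def q_def)
      then have qup: "q \<in> up \<Z>"
        by (auto simp: up_def)
      then have q: "q \<in> carrier (UP \<Z>)"
        by (simp add: UP_def)
      have "p = ?m \<otimes>\<^bsub>UP \<Z>\<^esub> q"
      proof (rule UP.up_eqI)
        fix k :: nat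
        \<comment> \<open>Degrees 0 and 1 are treated apart; a degree from 2 on is written as k - 2
          + 2 to fit \<open>coeff_monom_mult\<close>.\<close>
        have "k = 0 \<or> k = 1 \<or> k = k - 2 + 2" by linarith
        then show "coeff (UP \<Z>) p k = coeff (UP \<Z>) (?m \<otimes>\<^bsub>UP \<Z>\<^esub> q) k"
        proof (elim disjE)
          assume k: "k = k - 2 + 2"
          have "coeff (UP \<Z>) (?m \<otimes>\<^bsub>UP \<Z>\<^esub> q) (k - 2 + 2) = coeff (UP \<Z>) q (k - 2)"
            unfolding m using UP.coeff_monom_mult[OF _ q, of 1 2 "k - 2"] by (simp add: add.commute)
          also have "\<dots> = coeff (UP \<Z>) p (k - 2 + 2)"
            using pup qup by (simp add: UP_def q_def)
          finally show ?thesis using k by simp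
        qed (use p q mc m_coeff in \<open>simp_all add: int_finsum_eq\<close>)
      qed (use p q mc in auto)
      also have "?m \<otimes>\<^bsub>UP \<Z>\<^esub> q \<in> Idl\<^bsub>UP \<Z>\<^esub> {?m}"
        by (intro ideal.I_r_closed UP.P.genideal_ideal UP.P.genideal_self' q) (use mc in auto)
      finally show "p \<in> Idl\<^bsub>UP \<Z>\<^esub> {?m}" .
    qed
  qed
qed

end

text \<open>\<open>truncate\<close> is constant on each coset of its kernel, so the image is a
  singleton. The homomorphism theorem provides the map in this form.\<close>

definition dual_pair :: "(nat \<Rightarrow> int) set \<Rightarrow> int \<times> int"
  where "dual_pair x = the_elem (truncate ` x)"

lemma ring_iso_dual_pair: "dual_pair \<in> ring_iso dual_integers dual_pairs"
  using ring_hom_ring.FactRing_iso_set[OF ring_hom_truncate truncate_surj]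
  unfolding kernel_truncate dual_integers_def[symmetric] dual_pair_def[abs_def] .

text \<open>Every element of \<Lambda> is x = \<open>re x\<close> + \<open>ep x\<close> \<epsilon>,
  and \<open>dual a b\<close> below is a + b\<epsilon>. The integers inside \<Lambda> are the
  elements \<open>dual k 0\<close>, and \<epsilon> is \<open>dual 0 1\<close>.\<close>

definition re :: "(nat \<Rightarrow> int) set \<Rightarrow> int"
  where "re x = fst (dual_pair x)"

definition ep :: "(nat \<Rightarrow> int) set \<Rightarrow> int"
  where "ep x = snd (dual_pair x)"

definition dual :: "int \<Rightarrow> int \<Rightarrow> (nat \<Rightarrow> int) set"
  where "dual a b = inv_into (carrier dual_integers) dual_pair (a, b)"

lemma bij_dual_pair: "bij_betw dual_pair (carrier dual_integers) UNIV"
  using ring_iso_dual_pair by (simp add: ring_iso_def dual_pairs_def)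

lemma dual_closed [simp]: "dual a b \<in> carrier dual_integers"
  unfolding dual_def using bij_dual_pair by (auto simp: bij_betw_def intro!: inv_into_into)

lemma dual_pair_dual: "dual_pair (dual a b) = (a, b)"
  unfolding dual_def using bij_dual_pair by (auto simp: bij_betw_def intro!: f_inv_into_f)

lemma re_dual [simp]: "re (dual a b) = a"
  and ep_dual [simp]: "ep (dual a b) = b"
  by (simp_all add: re_def ep_def dual_pair_dual)

lemma dual_eqI:
  assumes "x \<in> carrier dual_integers" "y \<in> carrier dual_integers" "re x = re y" "ep x = ep y"
  shows "x = y"
  using assms bij_dual_pair by (auto simp: bij_betw_def re_def ep_def inj_on_def prod_eq_iff)

lemma dual_re_ep [simp]: "x \<in> carrier dual_integers \<Longrightarrow> dual (re x) (ep x) = x"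
  by (rule dual_eqI) auto

lemma
  assumes "x \<in> carrier dual_integers" "y \<in> carrier dual_integers"
  shows re_add [simp]: "re (x \<oplus>\<^bsub>dual_integers\<^esub> y) = re x + re y"
    and ep_add [simp]: "ep (x \<oplus>\<^bsub>dual_integers\<^esub> y) = ep x + ep y"
    and re_mult [simp]: "re (x \<otimes>\<^bsub>dual_integers\<^esub> y) = re x * re y"
    and ep_mult [simp]: "ep (x \<otimes>\<^bsub>dual_integers\<^esub> y) = re x * ep y + ep x * re y"
  using ring_iso_memE(2,3)[OF ring_iso_dual_pair] assms
  by (simp_all add: re_def ep_def dual_pairs_def split_beta)

lemma re_zero [simp]: "re \<zero>\<^bsub>dual_integers\<^esub> = 0"
  and ep_zero [simp]: "ep \<zero>\<^bsub>dual_integers\<^esub> = 0"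
proof -
  interpret cring dual_integers by (rule cring_dual_integers)
  show "re \<zero>\<^bsub>dual_integers\<^esub> = 0" "ep \<zero>\<^bsub>dual_integers\<^esub> = 0"
    using re_add[OF zero_closed zero_closed] ep_add[OF zero_closed zero_closed] by auto
qed

lemma dual_zero: "\<zero>\<^bsub>dual_integers\<^esub> = dual 0 0"
  and dual_add: "dual a b \<oplus>\<^bsub>dual_integers\<^esub> dual c d = dual (a + c) (b + d)"
  and dual_mult: "dual a b \<otimes>\<^bsub>dual_integers\<^esub> dual c d = dual (a * c) (a * d + b * c)"
proof -
  interpret cring dual_integers by (rule cring_dual_integers)
  show "\<zero>\<^bsub>dual_integers\<^esub> = dual 0 0"
    "dual a b \<oplus>\<^bsub>dual_integers\<^esub> dual c d = dual (a + c) (b + d)"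
    "dual a b \<otimes>\<^bsub>dual_integers\<^esub> dual c d = dual (a * c) (a * d + b * c)"
    by (rule dual_eqI; simp)+
qed

subsection \<open>Adapted bases of subgroups of \<open>\<int>\<^sup>m\<close>\<close>

definition lincomb :: "nat \<Rightarrow> (nat \<Rightarrow> int) \<Rightarrow> (nat \<Rightarrow> nat \<Rightarrow> int) \<Rightarrow> nat \<Rightarrow> int"
  where "lincomb r k b = (\<lambda>i. \<Sum>j<r. k j * b j i)"

definition lattice :: "(nat \<Rightarrow> int) set \<Rightarrow> bool"
  where "lattice H \<longleftrightarrow> (\<lambda>i. 0) \<in> H \<and> (\<forall>g\<in>H. \<forall>h\<in>H. (\<lambda>i. g i + h i) \<in> H) \<and>
    (\<forall>a. \<forall>h\<in>H. (\<lambda>i. a * h i) \<in> H)"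

definition lattice_basis :: "(nat \<Rightarrow> int) set \<Rightarrow> nat \<Rightarrow> (nat \<Rightarrow> nat \<Rightarrow> int) \<Rightarrow> bool"
  where "lattice_basis H r b \<longleftrightarrow> (\<forall>j<r. b j \<in> H) \<and> (\<forall>h\<in>H. \<exists>k. h = lincomb r k b) \<and>
    (\<forall>k. lincomb r k b = (\<lambda>i. 0) \<longrightarrow> (\<forall>j<r. k j = 0))"

text \<open>The intersection of H with \<int>^n, inside one type of vectors that serves all n. These
  subgroups form the filtration along which bases are built.\<close>

definition supported :: "nat \<Rightarrow> (nat \<Rightarrow> int) set \<Rightarrow> (nat \<Rightarrow> int) set"
  where "supported n H = {h \<in> H. \<forall>i\<ge>n. h i = 0}"

lemma lattice_supported: "lattice H \<Longrightarrow> lattice (supported n H)"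
  by (auto simp: lattice_def supported_def)

lemma
  assumes "lattice H" "h \<in> H"
  shows lattice_smult: "(\<lambda>i. a * h i) \<in> H"
    and lattice_add: "g \<in> H \<Longrightarrow> (\<lambda>i. g i + h i) \<in> H"
  using assms by (auto simp: lattice_def)

lemma lincomb_cong:
  "(\<And>j. j < r \<Longrightarrow> k j = k' j) \<Longrightarrow> (\<And>j. j < r \<Longrightarrow> b j = b' j) \<Longrightarrow> lincomb r k b = lincomb r k' b'"
  by (simp add: lincomb_def)

lemma lincomb_closed:
  assumes "lattice H" "\<And>j. j < r \<Longrightarrow> b j \<in> H"
  shows "lincomb r k b \<in> H"
  using assms(2)
proof (induction r)
  case 0
  then show ?case using assms(1) by (simp add: lincomb_def lattice_def)
next
  case (Suc r)
  then have "lincomb r k b \<in> H" "(\<lambda>i. k r * b r i) \<in> H"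
    using assms(1) by (auto simp: lattice_def)
  then have "(\<lambda>i. lincomb r k b i + k r * b r i) \<in> H"
    using assms(1) by (auto simp: lattice_def)
  then show ?case by (simp add: lincomb_def)
qed

text \<open>Coordinate m maps the larger subgroup onto an ideal of \<int>, and the smaller one is
  the kernel. If the ideal is zero, nothing changes; otherwise a preimage of a generator is appended
  to the basis.\<close>

lemma lattice_basis_extend_Suc:
  assumes H: "lattice H" and b: "lattice_basis (supported m H) r b"
  shows "\<exists>r'\<ge>r. \<exists>b'. (\<forall>j<r. b' j = b j) \<and> lattice_basis (supported (Suc m) H) r' b'"
proof (cases "\<forall>h\<in>supported (Suc m) H. h m = 0")
  case True
  then have "supported (Suc m) H = supported m H"
    by (auto simp: supported_def Suc_le_eq) (metis le_neq_implies_less)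
  then show ?thesis using b by auto
next
  case False
  define S where "S = supported (Suc m) H"
  have S: "lattice S"
    unfolding S_def by (rule lattice_supported[OF H])
  \<comment> \<open>A generator of the ideal of m-th coordinates is a nonzero one of least absolute
    value.\<close>
  obtain g where g: "g \<in> S" "g m \<noteq> 0"
    and min: "\<And>h. h \<in> S \<Longrightarrow> h m \<noteq> 0 \<Longrightarrow> nat \<bar>g m\<bar> \<le> nat \<bar>h m\<bar>"
  proof -
    obtain h where "h \<in> S \<and> h m \<noteq> 0"
      using False S_def by blast
    from ex_has_least_nat[of "\<lambda>h. h \<in> S \<and> h m \<noteq> 0", OF this, of "\<lambda>h. nat \<bar>h m\<bar>"] that
    show thesis by metis
  qed
  define b' where "b' = b(r := g)"
  have lc: "lincomb (Suc r) k b' = (\<lambda>i. lincomb r k b i + k r * g i)" for k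
    by (simp add: lincomb_def b'_def)
  have b_m: "b j m = 0" if "j < r" for j
    using b that by (auto simp: lattice_basis_def supported_def)
  have "lattice_basis S (Suc r) b'"
    unfolding lattice_basis_def
  proof (intro conjI allI ballI impI)
    fix j assume "j < Suc r"
    then show "b' j \<in> S"
      using g b by (auto simp: b'_def lattice_basis_def supported_def S_def less_Suc_eq)
  next
    fix h assume h: "h \<in> S"
    \<comment> \<open>Division with remainder: subtracting q g from h leaves an m-th coordinate
      smaller than that of g in absolute value, hence zero by minimality.\<close>
    define q where "q = h m div g m"
    have "(\<lambda>i. (- q) * g i) \<in> S"
      by (rule lattice_smult[OF S g(1)])
    then have "(\<lambda>i. h i + (- q) * g i) \<in> S"
      by (rule lattice_add[OF S]) (rule h)
    moreover have "h m + (- q) * g m = h m mod g m"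
      by (simp add: q_def minus_div_mult_eq_mod)
    moreover have "\<bar>h m mod g m\<bar> < \<bar>g m\<bar>"
      using g(2) by (rule abs_mod_less)
    ultimately have h': "(\<lambda>i. h i + (- q) * g i) \<in> S" "h m + (- q) * g m = 0"
      using min[of "\<lambda>i. h i + (- q) * g i"] by (force, smt (verit) nat_le_eq_zle)
    have "(\<lambda>i. h i + (- q) * g i) \<in> supported m H"
      using h' unfolding supported_def S_def
      by (auto simp: Suc_le_eq) (metis le_neq_implies_less)
    then obtain k where "(\<lambda>i. h i + (- q) * g i) = lincomb r k b"
      using b by (auto simp: lattice_basis_def)
    then have "lincomb r k b i = h i - q * g i" for i
      by (auto simp: fun_eq_iff)
    moreover have "lincomb r (k(r := q)) b = lincomb r k b"
      by (rule lincomb_cong) auto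
    ultimately have "h = lincomb (Suc r) (k(r := q)) b'"
      unfolding lc by auto
    then show "\<exists>k. h = lincomb (Suc r) k b'" by blast
  next
    fix k j assume 0: "lincomb (Suc r) k b' = (\<lambda>i. 0)" and j: "j < Suc r"
    \<comment> \<open>At coordinate m all old basis vectors vanish, so the coefficient of g must be
      zero.\<close>
    have "lincomb r k b m + k r * g m = 0"
      using 0 unfolding lc by metis
    then have kr: "k r = 0"
      using g b_m by (simp add: lincomb_def)
    then have "lincomb r k b = (\<lambda>i. 0)"
      using 0 unfolding lc by simp
    then show "k j = 0"
      using b j kr by (auto simp: lattice_basis_def less_Suc_eq)
  qed
  then show ?thesis
    unfolding S_def by (intro exI[of _ "Suc r"] conjI exI[of _ b']) (auto simp: b'_def)
qed

text \<open>The clause that the first r vectors are kept is what later yields a basis adapted to the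
  subgroup of vectors in \<epsilon>\<Lambda>^n.\<close>

lemma lattice_basis_extend:
  assumes H: "lattice H" and b: "lattice_basis (supported m H) r b"
  shows "\<exists>r'\<ge>r. \<exists>b'. (\<forall>j<r. b' j = b j) \<and> lattice_basis (supported (m + n) H) r' b'"
proof (induction n)
  case 0
  then show ?case using b by auto
next
  case (Suc n)
  then obtain r' b' where r': "r' \<ge> r" "\<forall>j<r. b' j = b j" "lattice_basis (supported (m + n) H) r' b'"
    by blast
  from lattice_basis_extend_Suc[OF H r'(3)] obtain r'' b'' where
    "r'' \<ge> r'" "\<forall>j<r'. b'' j = b' j" "lattice_basis (supported (m + Suc n) H) r'' b''"
    by auto
  then show ?case using r' by (intro exI[of _ r''] conjI exI[of _ b'']) auto
qed

lemma lattice_basis_exists: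
  assumes "lattice H"
  shows "\<exists>r b. lattice_basis (supported n H) r b"
proof -
  have "supported 0 H = {\<lambda>i. 0}"
    using assms by (auto simp: supported_def lattice_def)
  then have "lattice_basis (supported 0 H) 0 (\<lambda>_ _. 0)"
    by (simp add: lattice_basis_def lincomb_def)
  from lattice_basis_extend[OF assms this, of n] show ?thesis by auto
qed

subsection \<open>Total acyclicity from a homotopy over \<open>\<int>\<close>\<close>

lemma module_iso_trans:
  assumes "module_iso R L M" "module_iso R M N"
  shows "module_iso R L N"
proof -
  obtain f g where f: "f \<in> module_hom R L M" "bij_betw f (carrier L) (carrier M)"
    and g: "g \<in> module_hom R M N" "bij_betw g (carrier M) (carrier N)"
    using assms unfolding module_iso_def by blast
  have "g \<circ> f \<in> module_hom R L N"
    using f(1) g(1) by (auto simp: module_hom_def Pi_iff)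
  then show ?thesis
    unfolding module_iso_def using bij_betw_trans[OF f(2) g(2)] by blast
qed

text \<open>Closure of M under its operations is what makes the inverse map linear. It is easier to
  supply for a kernel record than a full module structure.\<close>

lemma module_iso_sym:
  assumes iso: "module_iso R M N"
    and add: "\<And>x y. x \<in> carrier M \<Longrightarrow> y \<in> carrier M \<Longrightarrow> x \<oplus>\<^bsub>M\<^esub> y \<in> carrier M"
    and smult: "\<And>a x. a \<in> carrier R \<Longrightarrow> x \<in> carrier M \<Longrightarrow> a \<odot>\<^bsub>M\<^esub> x \<in> carrier M"
  shows "module_iso R N M"
proof -
  obtain f where f: "f \<in> module_hom R M N" and bij: "bij_betw f (carrier M) (carrier N)"
    using iso unfolding module_iso_def by blast
  define g where "g = inv_into (carrier M) f"
  have g: "g y \<in> carrier M" "f (g y) = y" if "y \<in> carrier N" for y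
    using bij that unfolding g_def by (auto simp: bij_betw_def inv_into_into f_inv_into_f)
  have gf: "g (f x) = x" if "x \<in> carrier M" for x
    using bij that unfolding g_def by (auto simp: bij_betw_def)
  have "g \<in> module_hom R N M"
    unfolding module_hom_def
  proof (intro CollectI conjI ballI)
    fix x y assume xy: "x \<in> carrier N" "y \<in> carrier N"
    have "f (g x \<oplus>\<^bsub>M\<^esub> g y) = x \<oplus>\<^bsub>N\<^esub> y"
      using f g xy by (simp add: module_hom_def)
    then show "g (x \<oplus>\<^bsub>N\<^esub> y) = g x \<oplus>\<^bsub>M\<^esub> g y"
      using gf add g xy by metis
  next
    fix a x assume ax: "a \<in> carrier R" "x \<in> carrier N"
    have "f (a \<odot>\<^bsub>M\<^esub> g x) = a \<odot>\<^bsub>N\<^esub> x"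
      using f g ax by (simp add: module_hom_def)
    then show "g (a \<odot>\<^bsub>N\<^esub> x) = a \<odot>\<^bsub>M\<^esub> g x"
      using gf smult g ax by metis
  qed (use g in auto)
  then show ?thesis
    unfolding module_iso_def using bij_betw_inv_into[OF bij] g_def by blast
qed

lemma module_hom_zero:
  assumes "module R M" "module R N" "f \<in> module_hom R M N"
  shows "f \<zero>\<^bsub>M\<^esub> = \<zero>\<^bsub>N\<^esub>"
proof -
  interpret M: module R M by fact
  interpret N: module R N by fact
  \<comment> \<open>\<open>module_hom\<close> has no clause about zero; it is recovered from f(0 x)
    = 0 f(x).\<close>
  have "f (\<zero>\<^bsub>R\<^esub> \<odot>\<^bsub>M\<^esub> \<zero>\<^bsub>M\<^esub>) = \<zero>\<^bsub>R\<^esub> \<odot>\<^bsub>N\<^esub> f \<zero>\<^bsub>M\<^esub>" "f \<zero>\<^bsub>M\<^esub> \<in> carrier N"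
    using assms(3) by (auto simp: module_hom_def simp del: M.smult_l_null M.smult_r_null)
  then show ?thesis by simp
qed

text \<open>Closure under negation is multiplication by -1.\<close>

lemma (in module) submodule_by_smult:
  assumes H: "H \<subseteq> carrier M" "\<zero>\<^bsub>M\<^esub> \<in> H"
    and add: "\<And>x y. x \<in> H \<Longrightarrow> y \<in> H \<Longrightarrow> x \<oplus>\<^bsub>M\<^esub> y \<in> H"
    and smult: "\<And>a x. a \<in> carrier R \<Longrightarrow> x \<in> H \<Longrightarrow> a \<odot>\<^bsub>M\<^esub> x \<in> H"
  shows "submodule H R M"
proof (rule submoduleI[OF H _ add smult])
  fix x assume x: "x \<in> H"
  then have "\<ominus>\<^bsub>M\<^esub> x = (\<ominus>\<^bsub>R\<^esub> \<one>\<^bsub>R\<^esub>) \<odot>\<^bsub>M\<^esub> x"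
    using H(1) smult_l_minus[of "\<one>\<^bsub>R\<^esub>" x] by auto
  then show "\<ominus>\<^bsub>M\<^esub> x \<in> H"
    using smult x by simp
qed

lemma submodule_closed:
  assumes "submodule H R M"
  shows "H \<subseteq> carrier M" "\<zero>\<^bsub>M\<^esub> \<in> H"
    "\<And>x y. x \<in> H \<Longrightarrow> y \<in> H \<Longrightarrow> x \<oplus>\<^bsub>M\<^esub> y \<in> H"
    "\<And>a x. a \<in> carrier R \<Longrightarrow> x \<in> H \<Longrightarrow> a \<odot>\<^bsub>M\<^esub> x \<in> H"
proof -
  interpret submodule H R M by fact
  show "H \<subseteq> carrier M" "\<zero>\<^bsub>M\<^esub> \<in> H"
    "\<And>x y. x \<in> H \<Longrightarrow> y \<in> H \<Longrightarrow> x \<oplus>\<^bsub>M\<^esub> y \<in> H"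
    "\<And>a x. a \<in> carrier R \<Longrightarrow> x \<in> H \<Longrightarrow> a \<odot>\<^bsub>M\<^esub> x \<in> H"
    using subset one_closed m_closed by auto
qed

lemma fg_projective_free_module:
  assumes "cring R"
  shows "fg_projective R (free_module R n)"
proof -
  interpret module R "free_module R n"
    by (rule module_free_module[OF assms])
  let ?F = "free_module R n"
  have "submodule (carrier ?F) R ?F" "submodule {\<zero>\<^bsub>?F\<^esub>} R ?F"
    by (rule submodule_by_smult; simp)+
  moreover have "carrier ?F \<inter> {\<zero>\<^bsub>?F\<^esub>} = {\<zero>\<^bsub>?F\<^esub>}"
    by auto
  moreover have "carrier ?F <+>\<^bsub>?F\<^esub> {\<zero>\<^bsub>?F\<^esub>} = carrier ?F"
    by (auto simp: set_add_def' intro!: bexI)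
  moreover have "module_iso R ?F (?F\<lparr>carrier := carrier ?F\<rparr>)"
    unfolding module_iso_def by (rule bexI[of _ id]) (auto simp: module_hom_def)
  ultimately show ?thesis
    unfolding fg_projective_def using module_axioms by blast
qed

text \<open>The kernel of \<open>d 0\<close> is a submodule of \<open>P 0\<close>, which embeds in a
  free module as a direct summand. This works over every commutative ring.\<close>

lemma G_proj_subset_sub:
  assumes R: "cring R"
  shows "G_proj R \<subseteq> sub R"
proof
  fix M assume M: "M \<in> G_proj R"
  then obtain P :: "int \<Rightarrow> ('a, nat \<Rightarrow> 'a) module" and d where fg: "M \<in> fg_modules R"
    and ta: "totally_acyclic R P d" and iso: "module_iso R M (module_ker (P 0) (P 1) (d 0))"
    unfolding G_proj_def by blast
  have P0: "fg_projective R (P 0)" and P1: "fg_projective R (P 1)"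
    and d: "d 0 \<in> module_hom R (P 0) (P 1)"
    using ta[unfolded totally_acyclic_def, THEN spec, of 0]
      ta[unfolded totally_acyclic_def, THEN spec, of 1] by simp_all
  from P0 obtain n A f where A: "submodule A R (free_module R n)"
    and f: "f \<in> module_hom R (P 0) ((free_module R n)\<lparr>carrier := A\<rparr>)"
    and bij: "bij_betw f (carrier (P 0)) A"
    unfolding fg_projective_def module_iso_def by auto
  define K where "K = module_ker (P 0) (P 1) (d 0)"
  interpret P0: module R "P 0" using P0 by (simp add: fg_projective_def)
  interpret P1: module R "P 1" using P1 by (simp add: fg_projective_def)
  interpret F: module R "free_module R n" by (rule module_free_module[OF R])
  have f': "f \<in> module_hom R (P 0) (free_module R n)"
    using f submodule_closed(1)[OF A] by (auto simp: module_hom_def)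
  have K: "carrier K \<subseteq> carrier (P 0)" "\<zero>\<^bsub>P 0\<^esub> \<in> carrier K"
    "x \<in> carrier K \<Longrightarrow> y \<in> carrier K \<Longrightarrow> x \<oplus>\<^bsub>P 0\<^esub> y \<in> carrier K"
    "a \<in> carrier R \<Longrightarrow> x \<in> carrier K \<Longrightarrow> a \<odot>\<^bsub>P 0\<^esub> x \<in> carrier K" for a x y
    using d module_hom_zero[OF P0.module_axioms P1.module_axioms d]
    by (auto simp: K_def module_ker_def module_hom_def)
  have "submodule (f ` carrier K) R (free_module R n)"
  proof (rule F.submodule_by_smult)
    show "f ` carrier K \<subseteq> carrier (free_module R n)"
      using f' K(1) by (auto simp: module_hom_def)
    show "\<zero>\<^bsub>free_module R n\<^esub> \<in> f ` carrier K"
      using module_hom_zero[OF P0.module_axioms F.module_axioms f'] K(2) by (metis imageI)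
  next
    fix x y assume "x \<in> f ` carrier K" "y \<in> f ` carrier K"
    then obtain u v where uv: "u \<in> carrier K" "v \<in> carrier K" "x = f u" "y = f v"
      by blast
    then have "x \<oplus>\<^bsub>free_module R n\<^esub> y = f (u \<oplus>\<^bsub>P 0\<^esub> v)"
      using f' K(1) by (auto simp: module_hom_def subset_iff)
    then show "x \<oplus>\<^bsub>free_module R n\<^esub> y \<in> f ` carrier K"
      using K(3) uv by blast
  next
    fix a x assume a: "a \<in> carrier R" and "x \<in> f ` carrier K"
    then obtain u where u: "u \<in> carrier K" "x = f u"
      by blast
    then have "a \<odot>\<^bsub>free_module R n\<^esub> x = f (a \<odot>\<^bsub>P 0\<^esub> u)"
      using f' K(1) a by (auto simp: module_hom_def subset_iff)
    then show "a \<odot>\<^bsub>free_module R n\<^esub> x \<in> f ` carrier K"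
      using K(4) a u by blast
  qed
  moreover have "module_iso R K ((free_module R n)\<lparr>carrier := f ` carrier K\<rparr>)"
    unfolding module_iso_def
  proof
    show "f \<in> module_hom R K ((free_module R n)\<lparr>carrier := f ` carrier K\<rparr>)"
      using f' K(1) by (auto simp: module_hom_def K_def module_ker_def)
    show "bij_betw f (carrier K) (carrier ((free_module R n)\<lparr>carrier := f ` carrier K\<rparr>))"
      using bij_betw_subset[OF bij K(1)] by simp
  qed
  ultimately show "M \<in> sub R"
    unfolding sub_def using fg module_iso_trans[OF iso[folded K_def]] by blast
qed

lemma strongly_G_proj_subset_G_proj: "strongly_G_proj R \<subseteq> G_proj R"
  unfolding strongly_G_proj_def G_proj_def by blast

text \<open>Compatibility of s with the scalars \<open>dual k 0\<close> means that s is
  \<int>-linear. For a form \<phi> killed by the dual differential, the composite of \<phi> with s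
  need not be \<Lambda>-linear, so its preimage is rebuilt from the \<epsilon>-coefficient of that
  composite.\<close>

lemma totally_acyclic_of_homotopy:
  fixes P :: "((nat \<Rightarrow> int) set, 'p) module"
  assumes P: "fg_projective dual_integers P"
    and d: "d \<in> module_hom dual_integers P P"
    and dd: "\<And>x. x \<in> carrier P \<Longrightarrow> d (d x) = \<zero>\<^bsub>P\<^esub>"
    and s: "\<And>x. x \<in> carrier P \<Longrightarrow> s x \<in> carrier P"
    and s_add: "\<And>x y. x \<in> carrier P \<Longrightarrow> y \<in> carrier P \<Longrightarrow> s (x \<oplus>\<^bsub>P\<^esub> y) = s x \<oplus>\<^bsub>P\<^esub> s y"
    and s_smult: "\<And>k x. x \<in> carrier P \<Longrightarrow> s (dual k 0 \<odot>\<^bsub>P\<^esub> x) = dual k 0 \<odot>\<^bsub>P\<^esub> s x"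
    and homotopy: "\<And>x. x \<in> carrier P \<Longrightarrow> d (s x) \<oplus>\<^bsub>P\<^esub> s (d x) = x"
  shows "totally_acyclic dual_integers (\<lambda>i. P) (\<lambda>i. d)"
proof -
  interpret P: module dual_integers P
    using P by (simp add: fg_projective_def)
  let ?L = dual_integers and ?D = "dual_module dual_integers P"
  have d_closed: "d x \<in> carrier P" if "x \<in> carrier P" for x
    using d that by (auto simp: module_hom_def)
  have d_smult: "d (a \<odot>\<^bsub>P\<^esub> x) = a \<odot>\<^bsub>P\<^esub> d x" if "a \<in> carrier ?L" "x \<in> carrier P" for a x
    using d that by (auto simp: module_hom_def)
  have d_add: "d (x \<oplus>\<^bsub>P\<^esub> y) = d x \<oplus>\<^bsub>P\<^esub> d y" if "x \<in> carrier P" "y \<in> carrier P" for x y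
    using d that by (auto simp: module_hom_def)
  have s_zero: "s \<zero>\<^bsub>P\<^esub> = \<zero>\<^bsub>P\<^esub>"
    using s_smult[of "\<zero>\<^bsub>P\<^esub>" 0] s[of "\<zero>\<^bsub>P\<^esub>"] by (simp flip: dual_zero)
  have exact: "exact_at P d P d P"
    unfolding exact_at_def module_ker_def
  proof (intro equalityI subsetI)
    fix x assume "x \<in> carrier (P\<lparr>carrier := {x \<in> carrier P. d x = \<zero>\<^bsub>P\<^esub>}\<rparr>)"
    then have x: "x \<in> carrier P" "d x = \<zero>\<^bsub>P\<^esub>" by auto
    then have "x = d (s x)"
      using homotopy[OF x(1)] s_zero d_closed s by simp
    then show "x \<in> d ` carrier P"
      using s x by blast
  qed (use d_closed dd in auto)
  have "exact_at ?D (dual_map P d) ?D (dual_map P d) ?D"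
    unfolding exact_at_def
  proof (intro equalityI subsetI)
    fix \<psi> assume "\<psi> \<in> dual_map P d ` carrier ?D"
    then obtain \<phi> where \<phi>: "\<phi> \<in> carrier ?D" "\<psi> = dual_map P d \<phi>" by blast
    \<comment> \<open>Applying the dual differential twice gives \<phi>(d(d x)) = \<phi>(0), so
      \<phi>(0) = 0 is needed.\<close>
    have "\<phi> (\<zero>\<^bsub>?L\<^esub> \<odot>\<^bsub>P\<^esub> \<zero>\<^bsub>P\<^esub>) = \<zero>\<^bsub>?L\<^esub> \<otimes>\<^bsub>?L\<^esub> \<phi> \<zero>\<^bsub>P\<^esub>" "\<phi> \<zero>\<^bsub>P\<^esub> \<in> carrier ?L"
      using \<phi>(1) by (auto simp: dual_module_def simp del: P.smult_l_null P.smult_r_null)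
    then have "\<phi> \<zero>\<^bsub>P\<^esub> = \<zero>\<^bsub>?L\<^esub>" by simp
    then show "\<psi> \<in> carrier (module_ker ?D ?D (dual_map P d))"
      using \<phi> d_closed d_add d_smult dd
      by (auto simp: module_ker_def dual_map_def dual_module_def compose_def PiE_iff
          fun_eq_iff extensional_def)
  next
    fix \<phi> assume "\<phi> \<in> carrier (module_ker ?D ?D (dual_map P d))"
    then have \<phi>: "\<phi> \<in> carrier P \<rightarrow>\<^sub>E carrier ?L"
      and \<phi>_add: "\<And>x y. x \<in> carrier P \<Longrightarrow> y \<in> carrier P \<Longrightarrow> \<phi> (x \<oplus>\<^bsub>P\<^esub> y) = \<phi> x \<oplus>\<^bsub>?L\<^esub> \<phi> y"
      and \<phi>_smult: "\<And>a x. a \<in> carrier ?L \<Longrightarrow> x \<in> carrier P \<Longrightarrow> \<phi> (a \<odot>\<^bsub>P\<^esub> x) = a \<otimes>\<^bsub>?L\<^esub> \<phi> x"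
      and "(\<lambda>x\<in>carrier P. \<phi> (d x)) = (\<lambda>x\<in>carrier P. \<zero>\<^bsub>?L\<^esub>)"
      by (auto simp: module_ker_def dual_map_def dual_module_def compose_def)
    then have \<phi>d: "\<phi> (d x) = \<zero>\<^bsub>?L\<^esub>" if "x \<in> carrier P" for x
      using that by (metis restrict_apply')
    have \<phi>_closed: "\<phi> x \<in> carrier ?L" if "x \<in> carrier P" for x
      using \<phi> that by auto
    \<comment> \<open>Apply \<phi> to the homotopy identity; the term \<phi>(d(s x))
      vanishes.\<close>
    have \<phi>sd: "\<phi> (s (d x)) = \<phi> x" if x: "x \<in> carrier P" for x
      using \<phi>_add[of "d (s x)" "s (d x)"] homotopy[OF x] \<phi>d[OF s[OF x]] \<phi>_closed d_closed s x
      by simp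
    \<comment> \<open>The \<open>\<int>\<close>-linear form \<open>\<mu>\<close> extends uniquely to a \<open>\<Lambda>\<close>-linear \<open>\<psi>\<close> with \<open>\<epsilon>\<close>-coefficient \<open>\<mu>\<close>.\<close>
    define \<mu> where "\<mu> x = ep (\<phi> (s x))" for x
    define \<psi> where "\<psi> = (\<lambda>x\<in>carrier P. dual (\<mu> (dual 0 1 \<odot>\<^bsub>P\<^esub> x)) (\<mu> x))"
    have \<mu>_add: "\<mu> (x \<oplus>\<^bsub>P\<^esub> y) = \<mu> x + \<mu> y" if "x \<in> carrier P" "y \<in> carrier P" for x y
      using that by (simp add: \<mu>_def s_add \<phi>_add s \<phi>_closed)
    have \<mu>_smult: "\<mu> (dual k 0 \<odot>\<^bsub>P\<^esub> x) = k * \<mu> x" if "x \<in> carrier P" for k x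
      using that by (simp add: \<mu>_def s_smult \<phi>_smult s \<phi>_closed)
    \<comment> \<open>Scaling by a is reduced to integer scalars and one multiplication by
      \<epsilon>.\<close>
    have smult_split: "a \<odot>\<^bsub>P\<^esub> x = dual (re a) 0 \<odot>\<^bsub>P\<^esub> x \<oplus>\<^bsub>P\<^esub> dual (ep a) 0 \<odot>\<^bsub>P\<^esub> (dual 0 1 \<odot>\<^bsub>P\<^esub> x)"
      if "a \<in> carrier ?L" "x \<in> carrier P" for a x
    proof -
      have "a = dual (re a) 0 \<oplus>\<^bsub>?L\<^esub> dual (ep a) 0 \<otimes>\<^bsub>?L\<^esub> dual 0 1"
        using that(1) by (simp add: dual_mult dual_add)
      also have "\<dots> \<odot>\<^bsub>P\<^esub> x
          = dual (re a) 0 \<odot>\<^bsub>P\<^esub> x \<oplus>\<^bsub>P\<^esub> dual (ep a) 0 \<odot>\<^bsub>P\<^esub> (dual 0 1 \<odot>\<^bsub>P\<^esub> x)"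
        using that(2) by (simp only: P.smult_l_distr P.smult_assoc1 dual_closed P.m_closed)
      finally show ?thesis .
    qed
    have \<mu>_smult_split: "\<mu> (a \<odot>\<^bsub>P\<^esub> x) = re a * \<mu> x + ep a * \<mu> (dual 0 1 \<odot>\<^bsub>P\<^esub> x)"
      if "a \<in> carrier ?L" "x \<in> carrier P" for a x
      using that by (subst smult_split) (simp_all add: \<mu>_add \<mu>_smult)
    \<comment> \<open>As \<epsilon>^2 = 0, the scalar \<epsilon>a has constant coefficient 0 and
      \<epsilon>-coefficient \<open>re a\<close>.\<close>
    have eps_smult: "\<mu> (dual 0 1 \<odot>\<^bsub>P\<^esub> (a \<odot>\<^bsub>P\<^esub> x)) = re a * \<mu> (dual 0 1 \<odot>\<^bsub>P\<^esub> x)"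
      if "a \<in> carrier ?L" "x \<in> carrier P" for a x
      using that \<mu>_smult_split[of "dual 0 1 \<otimes>\<^bsub>?L\<^esub> a" x] by (simp add: P.smult_assoc1)
    have "\<psi> (a \<odot>\<^bsub>P\<^esub> x) = a \<otimes>\<^bsub>?L\<^esub> \<psi> x" if "a \<in> carrier ?L" "x \<in> carrier P" for a x
      using that by (intro dual_eqI) (simp_all add: \<psi>_def eps_smult, subst \<mu>_smult_split, simp_all)
    moreover have "\<psi> (x \<oplus>\<^bsub>P\<^esub> y) = \<psi> x \<oplus>\<^bsub>?L\<^esub> \<psi> y" if "x \<in> carrier P" "y \<in> carrier P" for x y
      using that by (simp add: \<psi>_def P.smult_r_distr \<mu>_add dual_add)
    moreover have "\<psi> \<in> carrier P \<rightarrow>\<^sub>E carrier ?L"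
      by (simp add: \<psi>_def)
    ultimately have "\<psi> \<in> carrier ?D"
      by (simp add: dual_module_def)
    moreover have "\<phi> = dual_map P d \<psi>"
    proof
      fix x
      show "\<phi> x = dual_map P d \<psi> x"
      proof (cases "x \<in> carrier P")
        case True
        \<comment> \<open>The constant coefficient of \<psi>(d x) is \<mu>(\<epsilon> d x) =
          \<mu>(d(\<epsilon>x)), which is the \<epsilon>-coefficient of \<phi>(\<epsilon>x) =
          \<epsilon>\<phi>(x), that is, \<open>re (\<phi> x)\<close>.\<close>
        have "dual 0 1 \<odot>\<^bsub>P\<^esub> d x = d (dual 0 1 \<odot>\<^bsub>P\<^esub> x)"
          using True by (simp add: d_smult)
        then show ?thesis
          using True by (auto simp: dual_map_def compose_def \<psi>_def d_closed \<mu>_def \<phi>sd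
            \<phi>_smult \<phi>_closed)
      next
        case False
        then show ?thesis
          using \<phi> by (auto simp: dual_map_def compose_def)
      qed
    qed
    ultimately show "\<phi> \<in> dual_map P d ` carrier ?D" by blast
  qed
  with P d exact show ?thesis
    unfolding totally_acyclic_def by blast
qed

subsection \<open>Submodules of free modules over the dual integers\<close>

abbreviation "dual_free \<equiv> free_module dual_integers"

lemma
  shows free_closed: "x \<in> carrier (free_module R r) \<Longrightarrow> i < r \<Longrightarrow> x i \<in> carrier R"
    and free_add: "i < r \<Longrightarrow> (x \<oplus>\<^bsub>free_module R r\<^esub> y) i = x i \<oplus>\<^bsub>R\<^esub> y i"
    and free_smult: "i < r \<Longrightarrow> (a \<odot>\<^bsub>free_module R r\<^esub> x) i = a \<otimes>\<^bsub>R\<^esub> x i"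
    and free_zero: "i < r \<Longrightarrow> \<zero>\<^bsub>free_module R r\<^esub> i = \<zero>\<^bsub>R\<^esub>"
  by (auto simp: free_module_def)

lemma dual_free_eqI:
  assumes "x \<in> carrier (dual_free r)" "y \<in> carrier (dual_free r)"
    and "\<And>i. i < r \<Longrightarrow> re (x i) = re (y i)" "\<And>i. i < r \<Longrightarrow> ep (x i) = ep (y i)"
  shows "x = y"
proof -
  have "x i = y i" if "i < r" for i
    using assms free_closed that by (intro dual_eqI) auto
  then show ?thesis
    using assms(1,2) by (intro PiE_ext[of x _ _ y]) (auto simp: free_module_def)
qed

lemma dual_vector_closed: "(\<lambda>i\<in>{..<r}. dual (f i) (g i)) \<in> carrier (dual_free r)"
  by (simp add: free_module_def)

section \<open>The differential \<epsilon>\<sigma> - E on \<Lambda>^r, its homotopy and its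
  kernel\<close>

locale dual_matrix =
  fixes r :: nat and E :: "nat \<Rightarrow> nat \<Rightarrow> int" and \<sigma> :: "nat \<Rightarrow> int"
  assumes sign_sq: "i < r \<Longrightarrow> \<sigma> i * \<sigma> i = 1"
    and sign_left: "i < r \<Longrightarrow> j < r \<Longrightarrow> \<sigma> i * E i j = E i j"
    and sign_right: "i < r \<Longrightarrow> j < r \<Longrightarrow> E i j * \<sigma> j = - E i j"
begin

text \<open>Expansion of (\<epsilon>\<sigma> - E)(u + \<epsilon>v) = -Eu + \<epsilon>(\<sigma>u -
  Ev) with integer vectors u and v.\<close>

definition diff :: "(nat \<Rightarrow> (nat \<Rightarrow> int) set) \<Rightarrow> nat \<Rightarrow> (nat \<Rightarrow> int) set"
  where "diff x = (\<lambda>i\<in>{..<r}. dual (- (\<Sum>j<r. E i j * re (x j)))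
    (\<sigma> i * re (x i) - (\<Sum>j<r. E i j * ep (x j))))"

definition htpy :: "(nat \<Rightarrow> (nat \<Rightarrow> int) set) \<Rightarrow> nat \<Rightarrow> (nat \<Rightarrow> int) set"
  where "htpy x = (\<lambda>i\<in>{..<r}. dual (\<sigma> i * ep (x i)) 0)"

lemma diff_closed: "diff x \<in> carrier (dual_free r)"
  and htpy_closed: "htpy x \<in> carrier (dual_free r)"
  unfolding diff_def htpy_def by (rule dual_vector_closed)+

text \<open>E^2 = E(\<sigma>E) = (E\<sigma>)E = -E^2, and \<int> has no 2-torsion.\<close>

lemma square_zero: "i < r \<Longrightarrow> (\<Sum>j<r. E i j * (\<Sum>k<r. E j k * u k)) = 0"
proof -
  assume i: "i < r"
  have "E i j * E j k = 0" if "j < r" "k < r" for j k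
  proof -
    have "E i j * E j k = (E i j * \<sigma> j) * E j k"
      using sign_left[OF that] by (simp add: mult.assoc)
    then show ?thesis
      using sign_right[OF i that(1)] by simp
  qed
  then have "E i j * (E j k * u k) = 0" if "j < r" "k < r" for j k
    using that by (metis mult.assoc mult_zero_left)
  then show ?thesis
    unfolding sum_distrib_left by (intro sum.neutral ballI) simp
qed

lemma sign_sign: "i < r \<Longrightarrow> \<sigma> i * (\<sigma> i * a) = a"
  using sign_sq[of i] by (simp flip: mult.assoc)

lemma sum_sign_left: "i < r \<Longrightarrow> \<sigma> i * (\<Sum>j<r. E i j * u j) = (\<Sum>j<r. E i j * u j)"
  by (simp add: sum_distrib_left mult.assoc[symmetric] sign_left)

lemma sum_sign_right: "i < r \<Longrightarrow> (\<Sum>j<r. E i j * (\<sigma> j * u j)) = - (\<Sum>j<r. E i j * u j)"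
  by (simp add: mult.assoc[symmetric] sign_right sum_negf)

lemma diff_hom: "diff \<in> module_hom dual_integers (dual_free r) (dual_free r)"
proof -
  interpret module dual_integers "dual_free r"
    by (rule module_free_module[OF cring_dual_integers])
  show ?thesis
    unfolding module_hom_def
  proof (intro CollectI conjI ballI)
    fix x y assume "x \<in> carrier (dual_free r)" "y \<in> carrier (dual_free r)"
    then show "diff (x \<oplus>\<^bsub>dual_free r\<^esub> y) = diff x \<oplus>\<^bsub>dual_free r\<^esub> diff y"
      by (intro dual_free_eqI[where r = r] diff_closed M.a_closed)
        (simp_all add: diff_def free_add free_closed sum.distrib algebra_simps)
  next
    fix a x assume "a \<in> carrier dual_integers" "x \<in> carrier (dual_free r)"
    then show "diff (a \<odot>\<^bsub>dual_free r\<^esub> x) = a \<odot>\<^bsub>dual_free r\<^esub> diff x"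
      by (intro dual_free_eqI[where r = r] diff_closed smult_closed)
        (simp_all add: diff_def free_smult free_closed sum.distrib sum_distrib_left algebra_simps)
  qed (use diff_closed in auto)
qed

text \<open>The constant part is E^2 u = 0. The \<epsilon>-part is -\<sigma>Eu - E\<sigma>u + E^2 v,
  where the first two terms cancel.\<close>

lemma diff_diff:
  assumes "x \<in> carrier (dual_free r)"
  shows "diff (diff x) = \<zero>\<^bsub>dual_free r\<^esub>"
proof -
  interpret module dual_integers "dual_free r"
    by (rule module_free_module[OF cring_dual_integers])
  show ?thesis
    by (rule dual_free_eqI[where r = r])
      (simp_all add: diff_closed free_zero, simp_all add: diff_def sum_negf square_zero
        right_diff_distrib sum_subtractf sum_sign_right sum_sign_left)
qed

lemma totally_acyclic_diff: "totally_acyclic dual_integers (\<lambda>i. dual_free r) (\<lambda>i. diff)"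
proof -
  interpret module dual_integers "dual_free r"
    by (rule module_free_module[OF cring_dual_integers])
  show ?thesis
  proof (rule totally_acyclic_of_homotopy[where s = htpy])
    show "fg_projective dual_integers (dual_free r)"
      by (rule fg_projective_free_module[OF cring_dual_integers])
  next
    fix x y assume "x \<in> carrier (dual_free r)" "y \<in> carrier (dual_free r)"
    then show "htpy (x \<oplus>\<^bsub>dual_free r\<^esub> y) = htpy x \<oplus>\<^bsub>dual_free r\<^esub> htpy y"
      by (intro dual_free_eqI[where r = r] htpy_closed M.a_closed)
        (simp_all add: htpy_def free_add free_closed algebra_simps)
  next
    fix k x assume "x \<in> carrier (dual_free r)"
    then show "htpy (dual k 0 \<odot>\<^bsub>dual_free r\<^esub> x) = dual k 0 \<odot>\<^bsub>dual_free r\<^esub> htpy x"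
      by (intro dual_free_eqI[where r = r] htpy_closed smult_closed)
        (simp_all add: htpy_def free_smult free_closed algebra_simps)
  next
    fix x assume "x \<in> carrier (dual_free r)"
    \<comment> \<open>For x = u + \<epsilon>v the summands are Ev + \<epsilon>v and u - Ev.\<close>
    then show "diff (htpy x) \<oplus>\<^bsub>dual_free r\<^esub> htpy (diff x) = x"
      by (intro dual_free_eqI[where r = r] M.a_closed htpy_closed diff_closed)
        (simp_all add: free_add, simp_all add: htpy_def diff_def sum_sign_right sum_sign_left
          right_diff_distrib sign_sign)
  qed (simp_all add: diff_hom diff_diff htpy_closed)
qed

text \<open>The \<epsilon>-part of the equation is \<sigma>u = Ev, equivalently u = \<sigma>Ev = Ev.
  The constant part Eu = 0 then follows from E^2 = 0. So the kernel consists of the elements Ev +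
  \<epsilon>v, with v in \<int>^r arbitrary.\<close>

lemma diff_eq_zero_iff:
  "diff x = \<zero>\<^bsub>dual_free r\<^esub> \<longleftrightarrow> (\<forall>i<r. re (x i) = (\<Sum>j<r. E i j * ep (x j)))" (is "?L \<longleftrightarrow> ?R")
proof
  assume ?L
  show ?R
  proof (intro allI impI)
    fix i assume i: "i < r"
    have "ep (diff x i) = 0"
      using \<open>?L\<close> i by (simp add: free_zero)
    then have "\<sigma> i * re (x i) = (\<Sum>j<r. E i j * ep (x j))"
      using i by (simp add: diff_def)
    then have "\<sigma> i * \<sigma> i * re (x i) = (\<Sum>j<r. E i j * ep (x j))"
      using sum_sign_left[OF i] by (metis mult.assoc)
    then show "re (x i) = (\<Sum>j<r. E i j * ep (x j))"
      using sign_sq[OF i] by simp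
  qed
next
  assume ?R
  interpret module dual_integers "dual_free r"
    by (rule module_free_module[OF cring_dual_integers])
  show ?L
    by (rule dual_free_eqI[where r = r])
      (use \<open>?R\<close> in \<open>simp_all add: diff_closed free_zero, simp_all add: diff_def square_zero sum_sign_left\<close>)
qed

end

text \<open>
  An element of \<open>\<Lambda>\<^sup>n\<close> is encoded by its \<open>\<epsilon>\<close>-coefficients, followed by its constant coefficients,
  so that \<open>\<epsilon>\<Lambda>\<^sup>n\<close> consists of the vectors supported on \<open>{..<n}\<close> and multiplication by \<open>\<epsilon>\<close> is
  \<open>shift\<close>.
\<close>

definition realize :: "nat \<Rightarrow> (nat \<Rightarrow> int) \<Rightarrow> nat \<Rightarrow> (nat \<Rightarrow> int) set"
  where "realize n h = (\<lambda>i\<in>{..<n}. dual (h (n + i)) (h i))"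

definition shift :: "nat \<Rightarrow> (nat \<Rightarrow> int) \<Rightarrow> nat \<Rightarrow> int"
  where "shift n h = (\<lambda>i. if i < n then h (n + i) else 0)"

lemma realize_closed: "realize n h \<in> carrier (dual_free n)"
  unfolding realize_def by (rule dual_vector_closed)

lemma realize_add:
  "realize n (\<lambda>i. g i + h i) = realize n g \<oplus>\<^bsub>dual_free n\<^esub> realize n h"
proof -
  interpret module dual_integers "dual_free n"
    by (rule module_free_module[OF cring_dual_integers])
  show ?thesis
    by (intro dual_free_eqI[where r = n] M.a_closed realize_closed) (simp_all add: free_add realize_def)
qed

lemma realize_smult:
  assumes "a \<in> carrier dual_integers"
  shows "a \<odot>\<^bsub>dual_free n\<^esub> realize n h = realize n (\<lambda>i. re a * h i + ep a * shift n h i)"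
proof -
  interpret module dual_integers "dual_free n"
    by (rule module_free_module[OF cring_dual_integers])
  show ?thesis
    using assms
    by (intro dual_free_eqI[where r = n] smult_closed realize_closed)
      (simp_all add: free_smult realize_def shift_def)
qed

lemma realize_surj:
  assumes "x \<in> carrier (dual_free n)"
  shows "\<exists>h. (\<forall>i\<ge>2 * n. h i = 0) \<and> realize n h = x"
proof (intro exI conjI)
  let ?h = "\<lambda>i. if i < n then ep (x i) else if i < 2 * n then re (x (i - n)) else 0"
  show "realize n ?h = x"
    using assms by (intro dual_free_eqI[where r = n] realize_closed) (auto simp: realize_def)
qed auto

lemma realize_inject:
  assumes "realize n g = realize n h" "\<forall>i\<ge>2 * n. g i = 0" "\<forall>i\<ge>2 * n. h i = 0"
  shows "g = h"
proof
  fix i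
  have *: "g (n + j) = h (n + j)" "g j = h j" if "j < n" for j
    using arg_cong[OF fun_cong[OF assms(1), of j], of re]
      arg_cong[OF fun_cong[OF assms(1), of j], of ep] that by (simp_all add: realize_def)
  consider "i < n" | "i = n + (i - n)" "i - n < n" | "i \<ge> 2 * n" by linarith
  then show "g i = h i"
    using * assms(2,3) by cases (simp, metis, simp)
qed

section \<open>From a submodule of \<Lambda>^n to a lattice with an adapted basis\<close>

text \<open>\<open>realize n\<close> reads only the coordinates below 2n. Requiring the others to
  vanish makes it a bijection from this set onto N.\<close>

definition submodule_lattice ::
    "nat \<Rightarrow> (nat \<Rightarrow> (nat \<Rightarrow> int) set) set \<Rightarrow> (nat \<Rightarrow> int) set"
  where "submodule_lattice n N = {h. (\<forall>i\<ge>2 * n. h i = 0) \<and> realize n h \<in> N}"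

lemma realize_submodule_lattice:
  assumes "submodule N dual_integers (dual_free n)" "x \<in> N"
  shows "\<exists>h\<in>submodule_lattice n N. realize n h = x"
  using realize_surj[of x n] submodule_closed(1)[OF assms(1)] assms(2)
  unfolding submodule_lattice_def by blast

text \<open>Both claims are closure of N under scalars: \<open>dual a 0\<close> for integer
  multiples, and \<open>dual 0 1\<close> for the shift.\<close>

lemma lattice_submodule_lattice:
  assumes N: "submodule N dual_integers (dual_free n)"
  shows "lattice (submodule_lattice n N)"
    and "h \<in> submodule_lattice n N \<Longrightarrow> shift n h \<in> supported n (submodule_lattice n N)"
proof -
  have smult: "realize n (\<lambda>i. re a * h i + ep a * shift n h i) \<in> N"
    if "h \<in> submodule_lattice n N" "a \<in> carrier dual_integers" for a h
    using submodule_closed(4)[OF N that(2), of "realize n h"] that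
    by (simp add: submodule_lattice_def realize_smult)
  have scale: "(\<lambda>i. a * h i) \<in> submodule_lattice n N" if "h \<in> submodule_lattice n N" for a h
    using smult[OF that, of "dual a 0"] that by (simp add: submodule_lattice_def)
  obtain h0 where "h0 \<in> submodule_lattice n N"
    using realize_submodule_lattice[OF N submodule_closed(2)[OF N]] by blast
  from scale[OF this, of 0] have "(\<lambda>i. 0) \<in> submodule_lattice n N"
    by simp
  then show "lattice (submodule_lattice n N)"
    using scale submodule_closed(3)[OF N]
    by (auto simp: lattice_def submodule_lattice_def realize_add)
  show "shift n h \<in> supported n (submodule_lattice n N)" if "h \<in> submodule_lattice n N"
    using smult[OF that, of "dual 0 1"]
    by (simp add: supported_def submodule_lattice_def shift_def)
qed

text \<open>Column j of E holds the coordinates of \<epsilon> times the j-th basis vector.\<close>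

lemma adapted_lattice_basis:
  assumes N: "submodule N dual_integers (dual_free n)"
  shows "\<exists>r b E \<sigma>. lattice_basis (submodule_lattice n N) r b \<and> dual_matrix r E \<sigma> \<and>
    (\<forall>j<r. shift n (b j) = lincomb r (\<lambda>i. E i j) b)"
proof -
  define H where "H = submodule_lattice n N"
  have H: "lattice H" and shift: "\<And>h. h \<in> H \<Longrightarrow> shift n h \<in> supported n H"
    using lattice_submodule_lattice[OF N] by (simp_all add: H_def)
  obtain p b0 where b0: "lattice_basis (supported n H) p b0"
    using lattice_basis_exists[OF H] by blast
  \<comment> \<open>All of H lives below 2n, so n extension steps from \<open>supported n H\<close>
    reach H.\<close>
  have "supported (n + n) H = H"
    by (auto simp: supported_def H_def submodule_lattice_def)
  with lattice_basis_extend[OF H b0, of n] obtain r b where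
    pr: "p \<le> r" and b0b: "\<forall>j<p. b j = b0 j" and b: "lattice_basis H r b"
    by auto
  have bH: "b j \<in> H" if "j < r" for j
    using b that by (simp add: lattice_basis_def)
  have "\<exists>k. shift n (b j) = lincomb p k b0" if "j < r" for j
    using b0 shift[OF bH[OF that]] by (simp add: lattice_basis_def)
  then obtain A where A: "\<And>j. j < r \<Longrightarrow> shift n (b j) = lincomb p (A j) b0"
    by metis
  \<comment> \<open>Only the block with rows below p and columns from p on is nonzero. Its rows have
    sign 1 and its columns sign -1, which gives the identities of
    \<open>dual_matrix\<close>.\<close>
  define E where "E i j = (if i < p \<and> p \<le> j then A j i else 0)" for i j
  define \<sigma> where "\<sigma> i = (if i < p then 1 else - 1 :: int)" for i
  have "shift n (b j) = lincomb r (\<lambda>i. E i j) b" if j: "j < r" for j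
  proof (cases "j < p")
    case True
    then have "b j \<in> supported n H"
      using b0 b0b by (simp add: lattice_basis_def)
    then have "shift n (b j) = (\<lambda>i. 0)"
      by (auto simp: shift_def supported_def)
    then show ?thesis
      using True by (simp add: lincomb_def E_def)
  next
    case False
    have "lincomb r (\<lambda>i. E i j) b = lincomb p (A j) b0"
      unfolding lincomb_def
    proof
      fix i
      show "(\<Sum>l<r. E l j * b l i) = (\<Sum>l<p. A j l * b0 l i)"
        using pr b0b False by (intro sum.mono_neutral_cong_right) (auto simp: E_def)
    qed
    then show ?thesis
      using A[OF j] by simp
  qed
  moreover have "dual_matrix r E \<sigma>"
    by unfold_locales (auto simp: E_def \<sigma>_def)
  ultimately show ?thesis
    using b unfolding H_def by blast
qed

text \<open>On the kernel, multiplication by \<epsilon> sends Ev + \<epsilon>v to \<epsilon>Ev, so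
  it acts on the parameter v by E. This is how \<epsilon> acts on coordinates in the adapted basis
  of N.\<close>

lemma submodule_iso_ker_diff:
  assumes N: "submodule N dual_integers (dual_free n)"
  shows "\<exists>r E \<sigma>. dual_matrix r E \<sigma> \<and>
    module_iso dual_integers ((dual_free n)\<lparr>carrier := N\<rparr>)
      (module_ker (dual_free r) (dual_free r) (dual_matrix.diff r E \<sigma>))"
proof -
  define H where "H = submodule_lattice n N"
  have H: "lattice H"
    using lattice_submodule_lattice[OF N] by (simp add: H_def)
  obtain r b E \<sigma> where b: "lattice_basis H r b" and "dual_matrix r E \<sigma>"
    and shift_b: "\<And>j. j < r \<Longrightarrow> shift n (b j) = lincomb r (\<lambda>i. E i j) b"
    using adapted_lattice_basis[OF N] unfolding H_def by blast
  interpret dual_matrix r E \<sigma> by fact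
  interpret F: module dual_integers "dual_free r"
    by (rule module_free_module[OF cring_dual_integers])
  define K where "K = module_ker (dual_free r) (dual_free r) diff"
  have K: "x \<in> carrier K \<longleftrightarrow> x \<in> carrier (dual_free r) \<and>
      (\<forall>i<r. re (x i) = (\<Sum>j<r. E i j * ep (x j)))" for x
    by (simp add: K_def module_ker_def diff_eq_zero_iff)
  have K_ops: "add K = add (dual_free r)" "smult K = smult (dual_free r)"
    by (simp_all add: K_def module_ker_def)
  \<comment> \<open>The parameter v of a kernel element is its \<epsilon>-part; it serves as
    coordinate vector in the basis b.\<close>
  define f where "f x = lincomb r (\<lambda>j. ep (x j)) b" for x
  have f_H: "f x \<in> H" for x
    using b unfolding f_def by (intro lincomb_closed[OF H]) (simp add: lattice_basis_def)
  have H_supp: "h i = 0" if "h \<in> H" "2 * n \<le> i" for h i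
    using that by (simp add: H_def submodule_lattice_def)
  \<comment> \<open>The coordinates of \<epsilon> f(x) are Ev, which is the constant part of x
    because x lies in the kernel.\<close>
  have shift_f: "shift n (f x) = lincomb r (\<lambda>j. re (x j)) b" if "x \<in> carrier K" for x
  proof
    fix i
    have "shift n (f x) i = (\<Sum>l<r. ep (x l) * shift n (b l) i)"
      by (simp add: shift_def f_def lincomb_def)
    also have "\<dots> = (\<Sum>l<r. \<Sum>j<r. ep (x l) * (E j l * b j i))"
      by (simp add: shift_b lincomb_def sum_distrib_left)
    also have "\<dots> = (\<Sum>j<r. \<Sum>l<r. ep (x l) * (E j l * b j i))"
      by (rule sum.swap)
    also have "\<dots> = (\<Sum>j<r. re (x j) * b j i)"
      using that by (simp add: K sum_distrib_right sum_distrib_left mult_ac)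
    finally show "shift n (f x) i = lincomb r (\<lambda>j. re (x j)) b i"
      by (simp add: lincomb_def)
  qed
  have "(\<lambda>x. realize n (f x)) \<in> module_hom dual_integers K ((dual_free n)\<lparr>carrier := N\<rparr>)"
    unfolding module_hom_def
  proof (intro CollectI conjI ballI)
    show "(\<lambda>x. realize n (f x)) \<in> carrier K \<rightarrow> carrier ((dual_free n)\<lparr>carrier := N\<rparr>)"
      using f_H by (auto simp: H_def submodule_lattice_def)
  next
    fix x y assume "x \<in> carrier K" "y \<in> carrier K"
    then have "ep ((x \<oplus>\<^bsub>K\<^esub> y) j) = ep (x j) + ep (y j)" if "j < r" for j
      using that by (simp add: K K_ops free_add free_closed[where r = r])
    then have "f (x \<oplus>\<^bsub>K\<^esub> y) = (\<lambda>i. f x i + f y i)"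
      by (simp add: f_def lincomb_def sum.distrib distrib_right)
    then show "realize n (f (x \<oplus>\<^bsub>K\<^esub> y))
        = realize n (f x) \<oplus>\<^bsub>(dual_free n)\<lparr>carrier := N\<rparr>\<^esub> realize n (f y)"
      by (simp add: realize_add)
  next
    fix a x assume a: "a \<in> carrier dual_integers" and x: "x \<in> carrier K"
    then have "ep ((a \<odot>\<^bsub>K\<^esub> x) j) = re a * ep (x j) + ep a * re (x j)" if "j < r" for j
      using that by (simp add: K K_ops free_smult free_closed[where r = r])
    then have "f (a \<odot>\<^bsub>K\<^esub> x) = (\<lambda>i. re a * f x i + ep a * lincomb r (\<lambda>j. re (x j)) b i)"
      by (simp add: f_def lincomb_def sum.distrib sum_distrib_left algebra_simps)
    then have "f (a \<odot>\<^bsub>K\<^esub> x) = (\<lambda>i. re a * f x i + ep a * shift n (f x) i)"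
      by (simp add: shift_f[OF x])
    then show "realize n (f (a \<odot>\<^bsub>K\<^esub> x))
        = a \<odot>\<^bsub>(dual_free n)\<lparr>carrier := N\<rparr>\<^esub> realize n (f x)"
      by (simp add: realize_smult[OF a])
  qed
  moreover have "bij_betw (\<lambda>x. realize n (f x)) (carrier K) N"
  proof (rule bij_betwI')
    fix x y assume xy: "x \<in> carrier K" "y \<in> carrier K"
    show "realize n (f x) = realize n (f y) \<longleftrightarrow> x = y"
    proof
      assume "realize n (f x) = realize n (f y)"
      then have "f x = f y"
        using realize_inject f_H H_supp by blast
      then have "lincomb r (\<lambda>j. ep (x j) - ep (y j)) b = (\<lambda>i. 0)"
        by (simp add: f_def lincomb_def left_diff_distrib sum_subtractf fun_eq_iff)
      then have ep: "ep (x j) = ep (y j)" if "j < r" for j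
        using b that unfolding lattice_basis_def by fastforce
      then show "x = y"
        using xy by (intro dual_free_eqI[where r = r]) (auto simp: K)
    qed auto
  next
    fix x assume "x \<in> carrier K"
    show "realize n (f x) \<in> N"
      using f_H by (simp add: H_def submodule_lattice_def)
  next
    fix y assume y: "y \<in> N"
    then obtain h where h: "h \<in> H" "realize n h = y"
      using realize_submodule_lattice[OF N y] H_def by blast
    then obtain k where k: "h = lincomb r k b"
      using b by (auto simp: lattice_basis_def)
    \<comment> \<open>The kernel element Ek + \<epsilon>k with parameter k.\<close>
    define x where "x = (\<lambda>i\<in>{..<r}. dual (\<Sum>j<r. E i j * k j) (k i))"
    have "x \<in> carrier K"
      unfolding K using dual_vector_closed by (simp add: x_def)
    moreover have "f x = h"
      unfolding f_def k by (rule lincomb_cong) (simp_all add: x_def)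
    ultimately show "\<exists>x\<in>carrier K. y = realize n (f x)"
      using h by blast
  qed
  ultimately have "module_iso dual_integers K ((dual_free n)\<lparr>carrier := N\<rparr>)"
    unfolding module_iso_def by auto
  then have "module_iso dual_integers ((dual_free n)\<lparr>carrier := N\<rparr>) K"
  proof (rule module_iso_sym)
    fix x y assume "x \<in> carrier K" "y \<in> carrier K"
    then show "x \<oplus>\<^bsub>K\<^esub> y \<in> carrier K"
      using diff_hom by (auto simp: K_def module_ker_def module_hom_def)
  next
    fix a x assume "a \<in> carrier dual_integers" "x \<in> carrier K"
    then show "a \<odot>\<^bsub>K\<^esub> x \<in> carrier K"
      using diff_hom by (auto simp: K_def module_ker_def module_hom_def)
  qed
  then show ?thesis
    unfolding K_def using dual_matrix_axioms by blast
qed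

text \<open>This closes the cycle of inclusions from strongly Gorenstein-projective to
  Gorenstein-projective to torsionless and back, so the three classes coincide over
  \<Lambda>.\<close>

lemma sub_subset_strongly_G_proj: "sub dual_integers \<subseteq> strongly_G_proj dual_integers"
proof
  fix M :: "((nat \<Rightarrow> int) set, 'm) module"
  assume "M \<in> sub dual_integers"
  then obtain n N where fg: "M \<in> fg_modules dual_integers"
    and N: "submodule N dual_integers (dual_free n)"
    and iso: "module_iso dual_integers M ((dual_free n)\<lparr>carrier := N\<rparr>)"
    unfolding sub_def by blast
  obtain r E \<sigma> where "dual_matrix r E \<sigma>"
    and iso': "module_iso dual_integers ((dual_free n)\<lparr>carrier := N\<rparr>)
      (module_ker (dual_free r) (dual_free r) (dual_matrix.diff r E \<sigma>))"
    using submodule_iso_ker_diff[OF N] by blast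
  then show "M \<in> strongly_G_proj dual_integers"
    unfolding strongly_G_proj_def
    using fg module_iso_trans[OF iso iso'] dual_matrix.totally_acyclic_diff by blast
qed

theorem proposition2p2p2:
  shows "(G_proj dual_integers :: ((nat \<Rightarrow> int) set, 'm) module set) = sub dual_integers \<and>
    (\<forall>M :: ((nat \<Rightarrow> int) set, 'm) module.
      M \<in> G_proj dual_integers \<longrightarrow> M \<in> strongly_G_proj dual_integers)"
  using G_proj_subset_sub[OF cring_dual_integers] sub_subset_strongly_G_proj
    strongly_G_proj_subset_G_proj by blast

end
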